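(* Let $K\geq0$ and $0<\varepsilon<1$ be constants. For every $k\in\mathbb{N}$, there exists a $2$-parametric maximization linear program $\Pi$ (with parameter set $\Lambda$) such that $F^*(\lambda)\geq K$ for all $\lambda\in\Lambda$, $\langle\Pi\rangle\in\mathcal{O}(\mathrm{poly}(k))$, and every $(1-\varepsilon)$-approximation set for $\Pi$ has cardinality in $\Omega(2^k)$.
   Context: A $2$-parametric maximization linear program is an instance $\Pi=(\Lambda,X,f)$ where $\Lambda=\{\lambda\in\mathbb{R}^2:Q\lambda\geq d\}$ is a polyhedron with rational data $Q,d$; $X=\{x\in\mathbb{R}^n: Ax\geq b\}$ is a polyhedron with rational data $A,b$; and $f=(f_1,f_2,f_3)^{\mathsf T}:X\to\mathbb{R}^3$ has linear components with rational data (additive constants allowed). The parametric value function is $F_\lambda(x)=\lambda_1f_1(x)+\lambda_2f_2(x)+f_3(x)$; for $\lambda\in\Lambda$, $\Pi(\lambda)$ is the linear program $\max_{x\in X}F_\lambda(x)$, which is required to be bounded, and $F^*(\lambda)=\max_{x\in X}F_\lambda(x)$. $\langle\Pi\rangle$ denotes the binary encoding length of $\Pi$. A set $S\subseteq X$ is a $(1-\varepsilon)$-approximation set for $\Pi$ if for every $\lambda\in\Lambda$ there is $x\in S$ with $F_\lambda(x)\geq(1-\varepsilon)F^*(\lambda)$. $\mathrm{poly}$ denotes a polynomial of bounded degree; the asymptotic bounds are as $k\to\infty$ for fixed constants $K,\varepsilon$ (hidden constants and the polynomial may depend on $K,\varepsilon$ but not on $k$). *)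

theory Defs
  imports
    Complex_Main
    "HOL-Library.Landau_Symbols"
    "HOL-Library.Log_Nat"
    "HOL-Computational_Algebra.Polynomial"
    "Jordan_Normal_Form.Matrix"
begin

text \<open>The data of a 2-parametric linear program: the parameter set is given by
  \<open>Q \<lambda> \<ge> d\<close>, the feasible set by \<open>A x \<ge> b\<close>, and the objective map
  \<open>f : X \<rightarrow> \<real>\<^sup>3\<close> by \<open>f x = C x + c\<close>.  The number of variables is \<open>dim_col A\<close>.\<close>

record para_lp =
  par_mat :: "rat mat"
  par_rhs :: "rat vec"
  con_mat :: "rat mat"
  con_rhs :: "rat vec"
  obj_mat :: "rat mat"
  obj_const :: "rat vec"

abbreviation real_mat :: "rat mat \<Rightarrow> real mat" where
  "real_mat \<equiv> map_mat real_of_rat"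

abbreviation real_vec :: "rat vec \<Rightarrow> real vec" where
  "real_vec \<equiv> map_vec real_of_rat"

text \<open>The order on vectors is componentwise.\<close>

definition polyhedron_of :: "rat mat \<Rightarrow> rat vec \<Rightarrow> real vec set" where
  "polyhedron_of M h = {z \<in> carrier_vec (dim_col M). real_mat M *\<^sub>v z \<ge> real_vec h}"

definition params :: "para_lp \<Rightarrow> real vec set" where
  "params P = polyhedron_of (par_mat P) (par_rhs P)"

definition feasible :: "para_lp \<Rightarrow> real vec set" where
  "feasible P = polyhedron_of (con_mat P) (con_rhs P)"

definition objectives :: "para_lp \<Rightarrow> real vec \<Rightarrow> real vec" where
  "objectives P x = real_mat (obj_mat P) *\<^sub>v x + real_vec (obj_const P)"

text \<open>Vector indices start at 0, so \<open>l $ 0\<close> and \<open>l $ 1\<close> are \<open>\<lambda>\<^sub>1\<close> and \<open>\<lambda>\<^sub>2\<close>.\<close>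

definition par_value :: "para_lp \<Rightarrow> real vec \<Rightarrow> real vec \<Rightarrow> real" where
  "par_value P l x =
     l $ 0 * objectives P x $ 0 + l $ 1 * objectives P x $ 1 + objectives P x $ 2"

text \<open>The maximum over \<open>X\<close>; it is attained whenever \<open>X\<close> is nonempty and the objective
  is bounded above on \<open>X\<close>.\<close>

definition opt_value :: "para_lp \<Rightarrow> real vec \<Rightarrow> real" where
  "opt_value P l = (GREATEST v. v \<in> par_value P l ` feasible P)"

definition two_parametric_max_lp :: "para_lp \<Rightarrow> bool" where
  "two_parametric_max_lp P \<longleftrightarrow>
     par_mat P \<in> carrier_mat (dim_vec (par_rhs P)) 2 \<and>
     con_mat P \<in> carrier_mat (dim_vec (con_rhs P)) (dim_col (con_mat P)) \<and>
     obj_mat P \<in> carrier_mat 3 (dim_col (con_mat P)) \<and>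
     obj_const P \<in> carrier_vec 3 \<and>
     feasible P \<noteq> {} \<and>
     (\<forall>l\<in>params P. bdd_above (par_value P l ` feasible P))"

definition approximation_set :: "real \<Rightarrow> para_lp \<Rightarrow> real vec set \<Rightarrow> bool" where
  "approximation_set \<alpha> P S \<longleftrightarrow>
     S \<subseteq> feasible P \<and> (\<forall>l\<in>params P. \<exists>x\<in>S. par_value P l x \<ge> \<alpha> * opt_value P l)"

text \<open>Binary encoding lengths: an integer takes a sign bit plus its
  \<open>\<lceil>log\<^sub>2 (\<bar>n\<bar> + 1)\<rceil>\<close> binary digits, a rational the lengths of its reduced numerator and
  denominator, and a vector or matrix one additional unit per entry.\<close>

definition enc_int :: "int \<Rightarrow> nat" where
  "enc_int n = 1 + floorlog 2 (nat \<bar>n\<bar>)"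

definition enc_rat :: "rat \<Rightarrow> nat" where
  "enc_rat r = enc_int (fst (quotient_of r)) + enc_int (snd (quotient_of r))"

definition enc_vec :: "rat vec \<Rightarrow> nat" where
  "enc_vec v = dim_vec v + (\<Sum>i<dim_vec v. enc_rat (v $ i))"

definition enc_mat :: "rat mat \<Rightarrow> nat" where
  "enc_mat M = dim_row M * dim_col M + (\<Sum>i<dim_row M. \<Sum>j<dim_col M. enc_rat (M $$ (i, j)))"

definition enc_length :: "para_lp \<Rightarrow> nat" where
  "enc_length P =
     enc_mat (par_mat P) + enc_vec (par_rhs P) +
     enc_mat (con_mat P) + enc_vec (con_rhs P) +
     enc_mat (obj_mat P) + enc_vec (obj_const P)"

end

theory Submission
  imports Defs "HOL-Analysis.Function_Topology"
begin

text \<open>A short linear program can have exponentially many vertices on a parabola. Write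
  \<open>s\<close>, \<open>x\<^sub>0, \<dots>, x\<^sub>k\<close> for the variables and let \<open>s \<le> 1\<close>, \<open>x\<^sub>i \<ge> 0\<close> and
  \<open>x\<^sub>i\<^sub>+\<^sub>1 \<le> min (2 x\<^sub>i) (2 (s - x\<^sub>i))\<close>. At \<open>s = 1\<close> the largest chain starting in \<open>x\<^sub>0\<close> is the orbit
  of \<open>x\<^sub>0\<close> under the tent map, and the weighted sum \<open>\<Sum>\<^sub>i 4\<^sup>-\<^sup>i x\<^sub>i\<close> (over \<open>i = 1, \<dots>, k\<close>) of that orbit
  is the piecewise linear interpolation of \<open>x\<^sub>0 - x\<^sub>0\<^sup>2\<close> at the multiples of \<open>2\<^sup>-\<^sup>k\<close>.
  What matters are the bound by the parabola (lemma \<open>chain_sum_le\<close>) and equality at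
  the \<open>2\<^sup>k + 1\<close> points \<open>t = j / 2\<^sup>k\<close> (lemma \<open>chain_sum_attained\<close>).

  The objective adds to a constant \<open>N \<ge> K\<close> the term \<open>C \<Sum>\<^sub>i 4\<^sup>k\<^sup>-\<^sup>i x\<^sub>i + \<lambda>\<^sub>1 x\<^sub>0 + \<lambda>\<^sub>2 s\<close>, and every
  \<open>\<lambda> \<in> \<real>\<^sup>2\<close> is admitted. The point \<open>0\<close> is feasible, so the optimum is never below \<open>N\<close>. For each
  \<open>t = j / 2\<^sup>k\<close> choose \<open>\<lambda>\<close> so that at \<open>s = 1\<close> the extra term is \<open>C 4\<^sup>k\<close> times the height above the
  tangent of the parabola at \<open>t\<close>, after this tangent has been lowered by \<open>4\<^sup>-\<^sup>k / 4\<close>. The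
  vertex at \<open>t\<close> then has value \<open>N + C/4\<close>, while a value above \<open>N\<close> forces
  \<open>x\<^sub>0 / s\<close> to lie within \<open>2\<^sup>-\<^sup>k\<^sup>-\<^sup>1\<close> of \<open>t\<close> (lemma \<open>good_chain_near\<close>). When \<open>C\<close> is so large that
  \<open>(1 - \<epsilon>) (N + C/4) > N\<close>, no feasible point can therefore serve two of these
  parameters, and an approximation set has at least \<open>2\<^sup>k + 1\<close> elements.

  The variable \<open>s\<close> homogenizes the polytope: scaling a point towards \<open>0\<close> scales the
  extra term. This is what keeps the optimum above \<open>N\<close> without restricting \<open>\<lambda>\<close>.\<close>

section \<open>Chains bounded by the tent map\<close>

text \<open>The sequence \<open>z\<close> lists \<open>s, x\<^sub>0, \<dots>, x\<^sub>k\<close>, so \<open>x\<^sub>i\<close> is \<open>z (i + 1)\<close>. The zero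
  tail makes the last step of the chain vacuous (\<open>x\<^sub>k\<^sub>+\<^sub>1 = 0\<close>), except that it
  leaves \<open>x\<^sub>k \<le> s\<close>, and lets chains be points of \<open>\<real>\<^sup>\<nat>\<close>
  with the product topology, where Tychonoff's theorem applies.\<close>

definition tent_chain :: "nat \<Rightarrow> (nat \<Rightarrow> real) \<Rightarrow> bool" where
  "tent_chain k z \<longleftrightarrow>
     z 0 \<le> 1 \<and>
     (\<forall>i\<le>k. 0 \<le> z (i + 1) \<and> z (i + 2) \<le> 2 * z (i + 1) \<and> z (i + 2) \<le> 2 * (z 0 - z (i + 1))) \<and>
     (\<forall>i>k+1. z i = 0)"

lemma tent_chain_range:
  assumes "tent_chain k z"
  shows "z i \<in> {0..1}" and "z (i + 1) \<le> z 0"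
proof -
  have *: "0 \<le> z (i + 1) \<and> z (i + 1) \<le> z 0" if "i \<le> k" for i
  proof -
    have nn: "0 \<le> z (i + 2)"
    proof (cases "i < k")
      case True
      then show ?thesis
        using assms unfolding tent_chain_def by (metis Suc_leI add_2_eq_Suc' Suc_eq_plus1)
    next
      case False
      then show ?thesis
        using assms unfolding tent_chain_def by simp
    qed
    then show ?thesis
      using assms that unfolding tent_chain_def by fastforce
  qed
  have s: "0 \<le> z 0" "z 0 \<le> 1"
    using *[of 0] assms unfolding tent_chain_def by auto
  have out: "z i = 0" if "i > k + 1" for i
    using assms that unfolding tent_chain_def by simp
  show "z (i + 1) \<le> z 0"
    using *[of i] out[of "i + 1"] s by (cases "i \<le> k") auto
  show "z i \<in> {0..1}"
  proof (cases i)
    case 0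
    then show ?thesis using s by simp
  next
    case (Suc m)
    then show ?thesis using *[of m] out[of i] s by (cases "m \<le> k") auto
  qed
qed

text \<open>The tent step is compatible with the parabola: if \<open>y \<le> x\<^sub>1 - x\<^sub>1\<^sup>2\<close> bounds the rest of
  the sum, then \<open>(x\<^sub>1 + y) / 4 \<le> (2 x\<^sub>1 - x\<^sub>1\<^sup>2) / 4\<close>, which increases in \<open>x\<^sub>1 \<le> 1\<close> and equals
  \<open>x\<^sub>0 - x\<^sub>0\<^sup>2\<close> at the largest admissible value of \<open>x\<^sub>1\<close>, on either branch of the tent. Here
  this is stated homogeneously in \<open>s\<close> and multiplied by \<open>4\<^sup>k\<close>.\<close>

lemma chain_sum_le:
  fixes x :: "nat \<Rightarrow> real"
  assumes "\<forall>i<k. x (i + 1) \<le> 2 * x i \<and> x (i + 1) \<le> 2 * (s - x i)"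
    and "\<forall>i\<le>k. 0 \<le> x i \<and> x i \<le> s"
  shows "s * (\<Sum>m<k. 4 ^ (k - 1 - m) * x (m + 1)) \<le> 4 ^ k * (s * x 0 - (x 0)\<^sup>2)"
  using assms
proof (induction k arbitrary: x)
  case 0
  then show ?case
    by (simp add: power2_eq_square mult_right_mono)
next
  case (Suc k)
  define u w where "u = x 0" and "w = x 1"
  have IH: "s * (\<Sum>m<k. 4 ^ (k - 1 - m) * x (m + 2)) \<le> 4 ^ k * (s * w - w\<^sup>2)"
    using Suc.IH[of "\<lambda>i. x (i + 1)"] Suc.prems by (simp add: w_def)
  \<comment> \<open>\<open>2 s w - w\<^sup>2 = s\<^sup>2 - (s - w)\<^sup>2\<close> and \<open>4 (s u - u\<^sup>2) = s\<^sup>2 - (s - 2 u)\<^sup>2\<close>\<close>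
  have "\<bar>s - 2 * u\<bar> \<le> \<bar>s - w\<bar>"
    using Suc.prems(1)[rule_format, of 0] Suc.prems(2)[rule_format, of 1]
    by (simp add: u_def w_def) linarith
  then have "(s - 2 * u)\<^sup>2 \<le> (s - w)\<^sup>2"
    by (simp only: abs_le_square_iff)
  then have step: "2 * s * w - w\<^sup>2 \<le> 4 * (s * u - u\<^sup>2)"
    by (simp add: power2_eq_square algebra_simps)
  have "s * (\<Sum>m<Suc k. 4 ^ (Suc k - 1 - m) * x (m + 1))
      = 4 ^ k * (s * w) + s * (\<Sum>m<k. 4 ^ (k - 1 - m) * x (m + 2))"
    unfolding sum.lessThan_Suc_shift by (simp add: w_def algebra_simps)
  also have "\<dots> \<le> 4 ^ k * (2 * s * w - w\<^sup>2)"
    using IH by (simp add: algebra_simps)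
  also have "\<dots> \<le> 4 ^ k * (4 * (s * u - u\<^sup>2))"
    using step by (intro mult_left_mono) auto
  also have "\<dots> = 4 ^ Suc k * (s * x 0 - (x 0)\<^sup>2)"
    by (simp add: u_def algebra_simps)
  finally show ?case .
qed

text \<open>Equality throughout the preceding argument: follow the tent map. It sends multiples
  of \<open>2\<^sup>-\<^sup>k\<close> to multiples of \<open>2\<^sup>-\<^sup>(\<^sup>k\<^sup>-\<^sup>1\<^sup>)\<close>, so after \<open>k\<close> steps the orbit is at \<open>0\<close> or \<open>1\<close>, where the
  parabola vanishes and the empty sum is exact.\<close>

lemma chain_sum_attained:
  fixes j k :: nat
  assumes "j \<le> 2 ^ k"
  shows "\<exists>x :: nat \<Rightarrow> real. x 0 = j / 2 ^ k \<and>
    (\<forall>i<k. x (i + 1) \<le> 2 * x i \<and> x (i + 1) \<le> 2 * (1 - x i)) \<and>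
    (\<forall>i. 0 \<le> x i \<and> x i \<le> 1) \<and>
    (\<Sum>m<k. 4 ^ (k - 1 - m) * x (m + 1)) = 4 ^ k * (x 0 - (x 0)\<^sup>2)"
  using assms
proof (induction k arbitrary: j)
  case 0
  then have "j = 0 \<or> j = 1" by (cases j) auto
  then show ?case
    by (intro exI[of _ "\<lambda>_. real j"]) auto
next
  case (Suc k)
  define t where "t = real j / 2 ^ Suc k"
  \<comment> \<open>the image of \<open>t\<close> under the tent map is \<open>j' / 2\<^sup>k\<close>\<close>
  define j' where "j' = (if j \<le> 2 ^ k then j else 2 ^ Suc k - j)"
  have "j' \<le> 2 ^ k"
    using Suc.prems by (auto simp: j'_def)
  from Suc.IH[OF this] obtain x where x: "x 0 = real j' / 2 ^ k"
    "\<forall>i<k. x (i + 1) \<le> 2 * x i \<and> x (i + 1) \<le> 2 * (1 - x i)"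
    "\<forall>i. 0 \<le> x i \<and> x i \<le> 1"
    "(\<Sum>m<k. 4 ^ (k - 1 - m) * x (m + 1)) = 4 ^ k * (x 0 - (x 0)\<^sup>2)"
    by blast
  have "real j \<le> 2 ^ Suc k"
    using Suc.prems by (metis of_nat_le_iff of_nat_numeral of_nat_power)
  then have t01: "0 \<le> t" "t \<le> 1"
    by (auto simp: t_def field_simps)
  have x0: "x 0 = (if j \<le> 2 ^ k then 2 * t else 2 * (1 - t))"
    using Suc.prems by (auto simp: x(1) j'_def t_def field_simps of_nat_diff)
  have jk: "j \<le> 2 ^ k \<longleftrightarrow> 2 * t \<le> 1"
  proof -
    have "j \<le> 2 ^ k \<longleftrightarrow> real j \<le> 2 ^ k"
      by (metis of_nat_le_iff of_nat_numeral of_nat_power)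
    then show ?thesis by (simp add: t_def field_simps)
  qed
  have sq: "2 * x 0 - (x 0)\<^sup>2 = 4 * (t - t\<^sup>2)"
    by (simp add: x0 power2_eq_square algebra_simps)
  let ?y = "case_nat t x"
  have "(\<Sum>m<Suc k. 4 ^ (Suc k - 1 - m) * ?y (m + 1)) = 4 ^ k * x 0 + (\<Sum>m<k. 4 ^ (k - 1 - m) * x (m + 1))"
    unfolding sum.lessThan_Suc_shift by simp
  also have "\<dots> = 4 ^ k * (2 * x 0 - (x 0)\<^sup>2)"
    unfolding x(4) by (simp add: algebra_simps)
  also have "\<dots> = 4 ^ Suc k * (t - t\<^sup>2)"
    by (simp add: sq)
  finally have "(\<Sum>m<Suc k. 4 ^ (Suc k - 1 - m) * ?y (m + 1)) = 4 ^ Suc k * (?y 0 - (?y 0)\<^sup>2)"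
    by simp
  moreover have "\<forall>i<Suc k. ?y (i + 1) \<le> 2 * ?y i \<and> ?y (i + 1) \<le> 2 * (1 - ?y i)"
    using x(2) x0 jk by (auto split: nat.split)
  moreover have "\<forall>i. 0 \<le> ?y i \<and> ?y i \<le> 1"
    using x(3) t01 by (auto split: nat.split)
  ultimately show ?case
    by (intro exI[of _ ?y]) (simp add: t_def)
qed

text \<open>Compactness is what turns the optimum into a genuine maximum for every parameter:
  the chains form a closed subset of a product of unit intervals.\<close>

lemma compact_tent_chains: "compact {z. tent_chain k z}"
proof -
  have "compact (PiE UNIV (\<lambda>_::nat. {0..1::real}))"
    using compactin_PiE[of "\<lambda>_. euclidean" UNIV "\<lambda>_::nat. {0..1::real}"]
    by (simp add: euclidean_product_topology)
  moreover have "closed {z. tent_chain k z}"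
    unfolding tent_chain_def
    by (intro closed_Collect_conj closed_Collect_all closed_Collect_imp closed_Collect_le
        closed_Collect_eq open_Collect_const continuous_intros continuous_on_product_coordinates)
  moreover have "{z. tent_chain k z} \<subseteq> PiE UNIV (\<lambda>_. {0..1})"
    using tent_chain_range(1) by (auto simp: PiE_iff)
  ultimately show ?thesis
    by (metis compact_Int_closed inf.absorb2)
qed

section \<open>The linear programs\<close>

text \<open>The coefficient of the variable \<open>z c\<close> in the \<open>q\<close>-th constraint belonging to \<open>x\<^sub>i\<close>. For
  \<open>i = k\<close> the column \<open>i + 2\<close> does not exist, which amounts to \<open>x\<^sub>k\<^sub>+\<^sub>1 = 0\<close>; the
  constraint \<open>- s \<ge> -1\<close> is repeated for every \<open>i\<close> to keep the rows uniform.\<close>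

definition con_coeff :: "nat \<Rightarrow> nat \<Rightarrow> nat \<Rightarrow> int" where
  "con_coeff i q c =
     (if q = 0 then of_bool (c = i + 1)
      else if q = 1 then 2 * of_bool (c = i + 1) - of_bool (c = i + 2)
      else if q = 2 then 2 * of_bool (c = 0) - 2 * of_bool (c = i + 1) - of_bool (c = i + 2)
      else - of_bool (c = 0))"

text \<open>Column \<open>c \<ge> 2\<close> belongs to \<open>x\<^sub>c\<^sub>-\<^sub>1\<close>, whose weight is \<open>4\<^sup>k\<^sup>-\<^sup>(\<^sup>c\<^sup>-\<^sup>1\<^sup>)\<close>. Scaling the sum by \<open>4\<^sup>k\<close>
  makes all data integral, at a cost of \<open>O(k)\<close> bits per entry.\<close>

definition obj_coeff :: "nat \<Rightarrow> nat \<Rightarrow> nat \<Rightarrow> nat \<Rightarrow> int" where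
  "obj_coeff C k r c =
     (if r = 0 then of_bool (c = 1)
      else if r = 1 then of_bool (c = 0)
      else if c < 2 then 0 else int C * 4 ^ (k + 1 - c))"

definition chain_lp :: "nat \<Rightarrow> nat \<Rightarrow> nat \<Rightarrow> para_lp" where
  "chain_lp N C k = \<lparr>
     par_mat = 0\<^sub>m 0 2,
     par_rhs = 0\<^sub>v 0,
     con_mat = mat (4 * (k + 1)) (k + 2) (\<lambda>(r, c). of_int (con_coeff (r div 4) (r mod 4) c)),
     con_rhs = vec (4 * (k + 1)) (\<lambda>r. of_int (if r mod 4 = 3 then -1 else 0)),
     obj_mat = mat 3 (k + 2) (\<lambda>(r, c). of_int (obj_coeff C k r c)),
     obj_const = vec 3 (\<lambda>r. of_int (if r = 2 then int N else 0))\<rparr>"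

definition coords :: "nat \<Rightarrow> real vec \<Rightarrow> nat \<Rightarrow> real" where
  "coords n v i = (if i < n then v $ i else 0)"

lemma params_chain_lp: "params (chain_lp N C k) = carrier_vec 2"
  by (auto simp: params_def polyhedron_of_def chain_lp_def less_eq_vec_def)

lemma real_int_mat_mult_vec:
  assumes "r < m" and "v \<in> carrier_vec n"
  shows "(real_mat (mat m n (\<lambda>(i, j). of_int (a i j))) *\<^sub>v v) $ r = (\<Sum>c<n. real_of_int (a r c) * v $ c)"
  using assms by (auto simp: scalar_prod_def atLeast0LessThan intro!: sum.cong)

lemma sum_coords: "(\<Sum>c<n. of_bool (c = i) * v $ c) = coords n v i"
proof -
  have "(\<Sum>c<n. of_bool (c = i) * v $ c) = (\<Sum>c<n. if c = i then v $ c else 0)"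
    by (rule sum.cong) auto
  then show ?thesis by (simp add: coords_def sum.delta)
qed

lemma con_row:
  "(\<Sum>c<n. real_of_int (con_coeff i q c) * v $ c) =
     (let z = coords n v in
      if q = 0 then z (i + 1)
      else if q = 1 then 2 * z (i + 1) - z (i + 2)
      else if q = 2 then 2 * z 0 - 2 * z (i + 1) - z (i + 2)
      else - z 0)"
  unfolding con_coeff_def Let_def sum_coords[symmetric]
  by (simp add: sum_subtractf left_diff_distrib sum_negf mult.assoc sum_distrib_left
      del: sum_of_bool_mult_eq sum_mult_of_bool_eq)

lemma all_less_4: "(\<forall>q<4. Q q) \<longleftrightarrow> Q 0 \<and> Q 1 \<and> Q 2 \<and> Q (3 :: nat)"
  by (auto simp: numeral_eq_Suc less_Suc_eq)

lemma feasible_chain_lp: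
  "v \<in> feasible (chain_lp N C k) \<longleftrightarrow> v \<in> carrier_vec (k + 2) \<and> tent_chain k (coords (k + 2) v)"
proof (cases "v \<in> carrier_vec (k + 2)")
  case True
  let ?z = "coords (k + 2) v" and ?M = "con_mat (chain_lp N C k)" and ?h = "con_rhs (chain_lp N C k)"
  let ?P = "\<lambda>i q. real_of_int (if q = 3 then -1 else 0) \<le> (\<Sum>c<k + 2. real_of_int (con_coeff i q c) * v $ c)"
  have row: "(real_vec ?h $ r \<le> (real_mat ?M *\<^sub>v v) $ r) \<longleftrightarrow> ?P (r div 4) (r mod 4)"
    if "r < 4 * (k + 1)" for r
  proof -
    have "(real_mat ?M *\<^sub>v v) $ r = (\<Sum>c<k + 2. real_of_int (con_coeff (r div 4) (r mod 4) c) * v $ c)"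
      unfolding chain_lp_def para_lp.simps
      using real_int_mat_mult_vec[OF that True, of "\<lambda>r. con_coeff (r div 4) (r mod 4)"] .
    moreover have "real_vec ?h $ r = real_of_int (if r mod 4 = 3 then -1 else 0)"
      using that by (simp add: chain_lp_def)
    ultimately show ?thesis by simp
  qed
  have dims: "dim_vec (real_mat ?M *\<^sub>v v) = 4 * (k + 1)" "dim_vec (real_vec ?h) = 4 * (k + 1)"
    "dim_col ?M = k + 2"
    by (simp_all add: chain_lp_def)
  have "v \<in> feasible (chain_lp N C k) \<longleftrightarrow> (\<forall>r<4 * (k + 1). real_vec ?h $ r \<le> (real_mat ?M *\<^sub>v v) $ r)"
    by (simp only: feasible_def polyhedron_of_def less_eq_vec_def mem_Collect_eq dims True simp_thms)
  also have "\<dots> \<longleftrightarrow> (\<forall>r<4 * (k + 1). ?P (r div 4) (r mod 4))"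
    by (intro all_cong1 imp_cong refl row)
  also have "\<dots> \<longleftrightarrow> (\<forall>i\<le>k. \<forall>q<4. ?P i q)"
  proof safe
    fix i q :: nat
    assume *: "\<forall>r<4 * (k + 1). ?P (r div 4) (r mod 4)" and "i \<le> k" "q < 4"
    then show "?P i q"
      using *[rule_format, of "4 * i + q"] by simp
  next
    fix r
    assume "\<forall>i\<le>k. \<forall>q<4. ?P i q" "r < 4 * (k + 1)"
    moreover from this have "r div 4 \<le> k" "r mod 4 < 4" by auto
    ultimately show "?P (r div 4) (r mod 4)" by blast
  qed
  also have "\<dots> \<longleftrightarrow> (\<forall>i\<le>k. ?P i 0 \<and> ?P i 1 \<and> ?P i 2 \<and> ?P i 3)"
    unfolding all_less_4 ..
  also have "\<dots> \<longleftrightarrow> tent_chain k ?z"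
    unfolding con_row Let_def tent_chain_def
    by (auto simp: coords_def[of _ _ "Suc (Suc _)"] coords_def algebra_simps)
  finally show ?thesis using True by simp
next
  case False
  then show ?thesis
    by (auto simp: feasible_def polyhedron_of_def chain_lp_def)
qed

definition chain_value :: "nat \<Rightarrow> nat \<Rightarrow> nat \<Rightarrow> real vec \<Rightarrow> (nat \<Rightarrow> real) \<Rightarrow> real" where
  "chain_value N C k l z =
     l $ 0 * z 1 + l $ 1 * z 0 + (C * (\<Sum>m<k. 4 ^ (k - 1 - m) * z (m + 2)) + N)"

lemma par_value_chain_lp:
  assumes "v \<in> carrier_vec (k + 2)"
  shows "par_value (chain_lp N C k) l v = chain_value N C k l (coords (k + 2) v)"
proof -
  let ?z = "coords (k + 2) v"
  have row: "objectives (chain_lp N C k) v $ r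
      = (\<Sum>c<k + 2. real_of_int (obj_coeff C k r c) * v $ c) + (if r = 2 then N else 0)"
    if "r < 3" for r
    unfolding objectives_def chain_lp_def para_lp.simps 
    using real_int_mat_mult_vec[OF that assms, of "obj_coeff C k"] that by simp
  have 0: "objectives (chain_lp N C k) v $ 0 = ?z 1"
    using row[of 0] by (simp add: obj_coeff_def sum_coords del: sum.lessThan_Suc flip: of_bool_def)
  have 1: "objectives (chain_lp N C k) v $ 1 = ?z 0"
    using row[of 1] by (simp add: obj_coeff_def sum_coords del: sum.lessThan_Suc flip: of_bool_def)
  have "(\<Sum>c<k + 2. real_of_int (obj_coeff C k 2 c) * v $ c)
      = (\<Sum>m<k. C * (4 ^ (k - 1 - m) * ?z (m + 2)))"
    unfolding add_2_eq_Suc' sum.lessThan_Suc_shift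
    by (simp add: obj_coeff_def coords_def algebra_simps)
  then have 2: "objectives (chain_lp N C k) v $ 2 = C * (\<Sum>m<k. 4 ^ (k - 1 - m) * ?z (m + 2)) + N"
    using row[of 2] by (simp add: sum_distrib_left)
  show ?thesis
    unfolding par_value_def chain_value_def 0 1 2 by simp
qed

text \<open>The transfer principle by which all further reasoning takes place on chains instead
  of vectors.\<close>

lemma par_values_chain_lp:
  "par_value (chain_lp N C k) l ` feasible (chain_lp N C k) = chain_value N C k l ` {z. tent_chain k z}"
proof (intro equalityI subsetI)
  fix y
  assume "y \<in> par_value (chain_lp N C k) l ` feasible (chain_lp N C k)"
  then show "y \<in> chain_value N C k l ` {z. tent_chain k z}"
    by (auto simp: feasible_chain_lp par_value_chain_lp)
next
  fix y
  assume "y \<in> chain_value N C k l ` {z. tent_chain k z}"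
  then obtain z where z: "tent_chain k z" "y = chain_value N C k l z"
    by auto
  have "coords (k + 2) (vec (k + 2) z) = z"
    using z(1) by (auto simp: coords_def tent_chain_def)
  then show "y \<in> par_value (chain_lp N C k) l ` feasible (chain_lp N C k)"
    using z
    by (intro image_eqI[of _ _ "vec (k + 2) z"])
      (simp_all only: feasible_chain_lp par_value_chain_lp vec_carrier simp_thms)
qed

lemma tent_chain_zero: "tent_chain k (\<lambda>_. 0)"
  by (simp add: tent_chain_def)

lemma compact_par_values_chain_lp:
  "compact (par_value (chain_lp N C k) l ` feasible (chain_lp N C k))"
  unfolding par_values_chain_lp chain_value_def
  by (intro compact_continuous_image compact_tent_chains continuous_intros
      continuous_on_subset[OF continuous_on_product_coordinates]) auto

lemma opt_value_chain_lp_ge: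
  assumes "tent_chain k z"
  shows "chain_value N C k l z \<le> opt_value (chain_lp N C k) l"
proof -
  let ?V = "par_value (chain_lp N C k) l ` feasible (chain_lp N C k)"
  have "chain_value N C k l z \<in> ?V"
    using assms unfolding par_values_chain_lp by blast
  then obtain b where b: "b \<in> ?V" "\<forall>y\<in>?V. y \<le> b" "chain_value N C k l z \<le> b"
    using compact_attains_sup[OF compact_par_values_chain_lp] by blast
  have "opt_value (chain_lp N C k) l = b"
    unfolding opt_value_def by (rule Greatest_equality) (use b in auto)
  then show ?thesis
    using b(3) by simp
qed

lemma two_parametric_chain_lp: "two_parametric_max_lp (chain_lp N C k)"
proof -
  have "par_value (chain_lp N C k) l ` feasible (chain_lp N C k) \<noteq> {}" for l
    unfolding par_values_chain_lp using tent_chain_zero by blast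
  moreover have "bdd_above (par_value (chain_lp N C k) l ` feasible (chain_lp N C k))" for l
    using compact_attains_sup[OF compact_par_values_chain_lp] calculation
    by (meson bdd_above.I)
  ultimately show ?thesis
    unfolding two_parametric_max_lp_def by (auto simp: chain_lp_def)
qed

section \<open>Encoding length\<close>

lemma enc_rat_of_int_le:
  assumes "\<bar>m\<bar> < 2 ^ w"
  shows "enc_rat (of_int m) \<le> w + 3"
proof -
  have "nat \<bar>m\<bar> < 2 ^ w"
    using assms by (simp add: nat_less_iff)
  then have "floorlog 2 (nat \<bar>m\<bar>) \<le> w"
    by (intro floorlog_leI) auto
  moreover have "floorlog 2 1 = 1"
    by (simp add: floorlog_def)
  ultimately show ?thesis
    by (simp add: enc_rat_def enc_int_def quotient_of_int flip: of_int_def)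
qed

lemma enc_vec_le:
  assumes "\<And>i. i < n \<Longrightarrow> enc_rat (f i) \<le> B"
  shows "enc_vec (vec n f) \<le> n * (B + 1)"
proof -
  have "(\<Sum>i<n. enc_rat (f i)) \<le> n * B"
    using sum_bounded_above[of "{..<n}" "\<lambda>i. enc_rat (f i)" B] assms by simp
  then show ?thesis
    by (simp add: enc_vec_def)
qed

lemma enc_mat_le:
  assumes "\<And>i j. i < m \<Longrightarrow> j < n \<Longrightarrow> enc_rat (f (i, j)) \<le> B"
  shows "enc_mat (mat m n f) \<le> m * n * (B + 1)"
proof -
  have "(\<Sum>j<n. enc_rat (f (i, j))) \<le> n * B" if "i < m" for i
    using sum_bounded_above[of "{..<n}" "\<lambda>j. enc_rat (f (i, j))" B] assms that by simp
  then have "(\<Sum>i<m. \<Sum>j<n. enc_rat (f (i, j))) \<le> m * (n * B)"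
    using sum_bounded_above[of "{..<m}" "\<lambda>i. \<Sum>j<n. enc_rat (f (i, j))" "n * B"] by simp
  then show ?thesis
    by (simp add: enc_mat_def algebra_simps)
qed

text \<open>There are \<open>O(k\<^sup>2)\<close> constraint entries of constant size and \<open>O(k)\<close> objective entries of
  \<open>O(k)\<close> bits.\<close>

lemma enc_length_chain_lp:
  "enc_length (chain_lp N C k) \<le> (60 + 3 * N + 3 * C) * (k + 2)\<^sup>2"
proof -
  have con: "enc_mat (con_mat (chain_lp N C k)) \<le> 4 * (k + 1) * (k + 2) * (5 + 1)"
    unfolding chain_lp_def para_lp.simps
  proof (rule enc_mat_le)
    fix i j
    have "\<bar>con_coeff (i div 4) (i mod 4) j\<bar> < 2 ^ 2"
      by (auto simp: con_coeff_def of_bool_def)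
    then show "enc_rat (case (i, j) of (r, c) \<Rightarrow> of_int (con_coeff (r div 4) (r mod 4) c)) \<le> 5"
      using enc_rat_of_int_le by fastforce
  qed
  have rhs: "enc_vec (con_rhs (chain_lp N C k)) \<le> 4 * (k + 1) * (4 + 1)"
    unfolding chain_lp_def para_lp.simps
    using enc_rat_of_int_le[of _ 1] by (intro enc_vec_le) fastforce
  \<comment> \<open>\<open>C < 2 ^ C\<close> is a crude bound, but \<open>C\<close> does not depend on \<open>k\<close>\<close>
  have pow: "int C * 4 ^ m < 2 ^ (C + 2 * k + 1)" if "m \<le> k" for m
  proof -
    have "int C < 2 ^ C"
      by (metis of_nat_less_two_power)
    moreover have "(4::int) ^ m \<le> 4 ^ k"
      using that by (simp add: power_increasing)
    ultimately have "int C * 4 ^ m < 2 ^ C * 4 ^ k"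
      by (intro mult_less_le_imp_less) auto
    also have "(2::int) ^ C * 4 ^ k = 2 ^ (C + 2 * k)"
      by (simp add: power_add power_mult)
    also have "\<dots> \<le> 2 ^ (C + 2 * k + 1)"
      by simp
    finally show ?thesis .
  qed
  have "enc_mat (obj_mat (chain_lp N C k)) \<le> 3 * (k + 2) * ((C + 2 * k + 4) + 1)"
    unfolding chain_lp_def para_lp.simps
  proof (rule enc_mat_le)
    fix i j
    have one: "(1::int) < 2 ^ (C + 2 * k + 1)"
      by (rule one_less_power) auto
    have "\<bar>obj_coeff C k i j\<bar> < 2 ^ (C + 2 * k + 1)"
      using pow[of "k + 1 - j"] one by (auto simp: obj_coeff_def of_bool_def)
    from enc_rat_of_int_le[OF this]
    show "enc_rat (case (i, j) of (r, c) \<Rightarrow> of_int (obj_coeff C k r c)) \<le> C + 2 * k + 4"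
      by simp
  qed
  moreover have "enc_vec (obj_const (chain_lp N C k)) \<le> 3 * ((N + 3) + 1)"
    unfolding chain_lp_def para_lp.simps
    using enc_rat_of_int_le[of _ N] by (intro enc_vec_le) (simp add: of_nat_less_two_power)
  moreover have "enc_mat (par_mat (chain_lp N C k)) = 0" "enc_vec (par_rhs (chain_lp N C k)) = 0"
    by (simp_all add: chain_lp_def enc_mat_def enc_vec_def)
  ultimately have "enc_length (chain_lp N C k) \<le>
      24 * ((k + 1) * (k + 2)) + 20 * (k + 1) + 3 * ((k + 2) * (C + 2 * k + 5)) + (3 * N + 12)"
    using con rhs unfolding enc_length_def by (simp add: algebra_simps)
  also have "\<dots> \<le> (60 + 3 * N + 3 * C) * (k + 2)\<^sup>2"
    by (simp add: power2_eq_square algebra_simps)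
  finally show ?thesis .
qed

section \<open>Parameters that share no approximate solution\<close>

text \<open>The tangent of \<open>x - x\<^sup>2\<close> at \<open>t\<close> is \<open>(1 - 2 t) x + t\<^sup>2\<close>; it is lowered by \<open>4\<^sup>-\<^sup>k / 4\<close> and then
  scaled by \<open>- C 4\<^sup>k\<close> to match the scaled sum.\<close>

definition tangent_param :: "nat \<Rightarrow> nat \<Rightarrow> nat \<Rightarrow> real vec" where
  "tangent_param C k j = (let t = real j / 2 ^ k in
     vec_of_list [- C * 4 ^ k * (1 - 2 * t), - C * (4 ^ k * t\<^sup>2 - 1 / 4)])"

lemma chain_value_tangent_param:
  fixes j k :: nat
  defines "t \<equiv> real j / 2 ^ k"
  shows "chain_value N C k (tangent_param C k j) z =
    N + C * ((\<Sum>m<k. 4 ^ (k - 1 - m) * z (m + 2)) - 4 ^ k * ((1 - 2 * t) * z 1 + t\<^sup>2 * z 0) + z 0 / 4)"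
  by (simp add: chain_value_def tangent_param_def Let_def t_def algebra_simps)

lemma opt_value_tangent_param:
  assumes "j \<le> 2 ^ k"
  shows "N + C / 4 \<le> opt_value (chain_lp N C k) (tangent_param C k j)"
proof -
  obtain x :: "nat \<Rightarrow> real" where x: "x 0 = j / 2 ^ k"
    "\<forall>i<k. x (i + 1) \<le> 2 * x i \<and> x (i + 1) \<le> 2 * (1 - x i)"
    "\<forall>i. 0 \<le> x i \<and> x i \<le> 1"
    "(\<Sum>m<k. 4 ^ (k - 1 - m) * x (m + 1)) = 4 ^ k * (x 0 - (x 0)\<^sup>2)"
    using chain_sum_attained[OF assms] by blast
  define z where "z i = (if i = 0 then 1 else if i \<le> k + 1 then x (i - 1) else 0)" for i
  have "tent_chain k z"
    using x(2,3) by (auto simp: tent_chain_def z_def)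
  moreover have "(\<Sum>m<k. 4 ^ (k - 1 - m) * z (m + 2)) = 4 ^ k * (x 0 - (x 0)\<^sup>2)"
    unfolding x(4)[symmetric] by (rule sum.cong) (auto simp: z_def)
  then have "chain_value N C k (tangent_param C k j) z = N + C / 4"
    unfolding chain_value_tangent_param
    by (simp add: x(1)[symmetric] z_def power2_eq_square algebra_simps)
  ultimately show ?thesis
    using opt_value_chain_lp_ge by metis
qed

text \<open>Relative to its tangent at \<open>t\<close>, the parabola at \<open>x\<close> has height \<open>- (x - t)\<^sup>2\<close>. So to
  exceed a tangent lowered by \<open>4\<^sup>-\<^sup>k / 4\<close>, the abscissa \<open>x = x\<^sub>0 / s\<close> must satisfy
  \<open>(x - t)\<^sup>2 < 4\<^sup>-\<^sup>k / 4\<close>. The claim is this inequality with denominators cleared, and its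
  strictness implies \<open>s > 0\<close>.\<close>

lemma good_chain_near:
  assumes z: "tent_chain k z" and good: "N < chain_value N C k (tangent_param C k j) z"
  shows "\<bar>2 ^ k * z 1 - j * z 0\<bar> < z 0 / 2"
proof -
  define t where "t = real j / 2 ^ k"
  define Y where "Y = (\<Sum>m<k. 4 ^ (k - 1 - m) * z (m + 2))"
  let ?s = "z 0" and ?u = "z 1"
  have range: "0 \<le> z (i + 1)" "z (i + 1) \<le> ?s" for i
    using tent_chain_range[OF z, of "i + 1"] tent_chain_range(2)[OF z, of i] by auto
  have "0 < C * (Y - 4 ^ k * ((1 - 2 * t) * ?u + t\<^sup>2 * ?s) + ?s / 4)"
    using good unfolding chain_value_tangent_param Y_def t_def by linarith
  then have pos: "0 < Y - 4 ^ k * ((1 - 2 * t) * ?u + t\<^sup>2 * ?s) + ?s / 4"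
    by (simp add: zero_less_mult_iff)
  have s: "?s > 0"
  proof (rule ccontr)
    assume "\<not> ?s > 0"
    then have "z i = 0" for i
      using range[of "i - 1"] range[of 0] by (cases i) force+
    then show False
      using pos by (simp add: Y_def)
  qed
  have "?s * Y \<le> 4 ^ k * (?s * ?u - ?u\<^sup>2)"
    using chain_sum_le[of k "\<lambda>i. z (i + 1)" ?s] z range by (simp add: tent_chain_def Y_def)
  moreover have "0 < ?s * (Y - 4 ^ k * ((1 - 2 * t) * ?u + t\<^sup>2 * ?s) + ?s / 4)"
    using pos s by simp
  ultimately have "4 ^ k * (?u - t * ?s)\<^sup>2 < (?s / 2)\<^sup>2"
    by (simp add: power2_eq_square algebra_simps)
  moreover have "4 ^ k * (?u - t * ?s)\<^sup>2 = (2 ^ k * ?u - j * ?s)\<^sup>2"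
  proof -
    have "(4::real) ^ k = (2 ^ k)\<^sup>2"
      by (simp add: power2_eq_square flip: power_mult_distrib)
    moreover have "2 ^ k * (?u - t * ?s) = 2 ^ k * ?u - j * ?s"
      by (simp add: t_def algebra_simps)
    ultimately show ?thesis
      by (metis power_mult_distrib)
  qed
  ultimately have "\<bar>2 ^ k * ?u - j * ?s\<bar> < \<bar>?s / 2\<bar>"
    by (metis abs_le_square_iff not_le)
  then show ?thesis
    using s by simp
qed

text \<open>The intervals of radius \<open>2\<^sup>-\<^sup>k\<^sup>-\<^sup>1\<close> around the multiples of \<open>2\<^sup>-\<^sup>k\<close> are disjoint, so
  choosing an approximate solution for each tangent parameter is injective.\<close>

lemma card_approximation_set_chain_lp:
  assumes S: "approximation_set (1 - \<epsilon>) (chain_lp N C k) S" and "finite S"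
    and \<epsilon>: "\<epsilon> < 1" and C: "N < (1 - \<epsilon>) * (N + C / 4)"
  shows "2 ^ k \<le> card S"
proof -
  let ?P = "chain_lp N C k" and ?l = "tangent_param C k"
  have "\<exists>x\<in>S. tent_chain k (coords (k + 2) x) \<and> N < chain_value N C k (?l j) (coords (k + 2) x)"
    if "j \<in> {..2 ^ k}" for j
  proof -
    have "?l j \<in> params ?P"
      unfolding params_chain_lp tangent_param_def Let_def by (intro carrier_vecI) simp
    then obtain x where x: "x \<in> S" "(1 - \<epsilon>) * opt_value ?P (?l j) \<le> par_value ?P (?l j) x"
      using S unfolding approximation_set_def by blast
    have "x \<in> feasible ?P"
      using S x(1) unfolding approximation_set_def by blast
    then have v: "tent_chain k (coords (k + 2) x)" "x \<in> carrier_vec (k + 2)"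
      unfolding feasible_chain_lp by auto
    have "(1 - \<epsilon>) * (N + C / 4) \<le> (1 - \<epsilon>) * opt_value ?P (?l j)"
      using opt_value_tangent_param[of j k N C] \<epsilon> that by (intro mult_left_mono) auto
    then have "N < chain_value N C k (?l j) (coords (k + 2) x)"
      using x(2) C unfolding par_value_chain_lp[OF v(2)] by linarith
    then show ?thesis using x(1) v(1) by blast
  qed
  then obtain g where g: "\<And>j. j \<in> {..2 ^ k} \<Longrightarrow> g j \<in> S \<and> tent_chain k (coords (k + 2) (g j)) \<and>
      N < chain_value N C k (?l j) (coords (k + 2) (g j))"
    by metis
  have "inj_on g {..2 ^ k}"
  proof (rule inj_onI)
    fix i j :: nat
    assume ij: "i \<in> {..2 ^ k}" "j \<in> {..2 ^ k}" "g i = g j"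
    define z where "z = coords (k + 2) (g i)"
    have z: "tent_chain k z" "N < chain_value N C k (?l i) z" "N < chain_value N C k (?l j) z"
      using g[OF ij(1)] g[OF ij(2)] ij(3) unfolding z_def by metis+
    have "\<bar>2 ^ k * z 1 - i * z 0\<bar> < z 0 / 2" "\<bar>2 ^ k * z 1 - j * z 0\<bar> < z 0 / 2"
      by (rule good_chain_near[OF z(1) z(2)], rule good_chain_near[OF z(1) z(3)])
    then have "\<bar>real i * z 0 - j * z 0\<bar> < z 0" and s: "0 < z 0"
      by linarith+
    then have "\<bar>real i - j\<bar> * z 0 < 1 * z 0"
      by (simp add: abs_mult flip: left_diff_distrib)
    then have "\<bar>real i - j\<bar> < 1"
      using s by (simp only: mult_less_cancel_right_pos)
    then show "i = j" by linarith
  qed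
  then have "card {..(2::nat) ^ k} \<le> card S"
    using g \<open>finite S\<close> by (intro card_inj_on_le[of g]) auto
  then show ?thesis by simp
qed

theorem theorem12:
  fixes K \<epsilon> :: real
  assumes "K \<ge> 0" and "0 < \<epsilon>" and "\<epsilon> < 1"
  shows "\<exists>P :: nat \<Rightarrow> para_lp.
    (\<forall>k. two_parametric_max_lp (P k) \<and> (\<forall>l\<in>params (P k). opt_value (P k) l \<ge> K)) \<and>
    (\<exists>p :: real poly. (\<lambda>k. real (enc_length (P k))) \<in> O(\<lambda>k. poly p (real k))) \<and>
    (\<exists>c>0. \<forall>\<^sub>F k in sequentially. \<forall>S.
       approximation_set (1 - \<epsilon>) (P k) S \<longrightarrow> infinite S \<or> real (card S) \<ge> c * 2 ^ k)"
proof -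
  obtain N :: nat where N: "K \<le> N"
    using real_arch_simple by blast
  \<comment> \<open>\<open>C/4\<close> is so large that the value \<open>N\<close> is not a \<open>(1 - \<epsilon>)\<close>-approximation of \<open>N + C/4\<close>\<close>
  obtain C :: nat where "4 * (N / (1 - \<epsilon>)) < C"
    using reals_Archimedean2 by blast
  then have "N / (1 - \<epsilon>) < N + C / 4"
    by simp
  then have C: "N < (1 - \<epsilon>) * (N + C / 4)"
    using assms(3) by (simp add: pos_divide_less_eq mult.commute)
  show ?thesis
  proof (intro exI[of _ "chain_lp N C"] conjI allI ballI)
    fix k
    show "two_parametric_max_lp (chain_lp N C k)"
      by (rule two_parametric_chain_lp)
    fix l
    show "K \<le> opt_value (chain_lp N C k) l"
      using opt_value_chain_lp_ge[OF tent_chain_zero, of N C k l] N by (simp add: chain_value_def)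
  next
    have "real (enc_length (chain_lp N C k)) \<le> (60 + 3 * N + 3 * C) * (k + 2)\<^sup>2" for k
      using enc_length_chain_lp[of N C k] by (metis of_nat_le_iff)
    then have "(\<lambda>k. real (enc_length (chain_lp N C k))) \<in> O(\<lambda>k. poly ([:2, 1:]\<^sup>2) (real k))"
      by (intro bigoI[of _ "60 + 3 * N + 3 * C"] always_eventually) (simp add: add.commute)
    then show "\<exists>p. (\<lambda>k. real (enc_length (chain_lp N C k))) \<in> O(\<lambda>k. poly p (real k))"
      by blast
  next
    have "infinite S \<or> 1 * 2 ^ k \<le> real (card S)"
      if "approximation_set (1 - \<epsilon>) (chain_lp N C k) S" for k S
      using card_approximation_set_chain_lp[OF that _ assms(3) C]
      by (metis mult_1 of_nat_le_iff of_nat_numeral of_nat_power)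
    then show "\<exists>c>0. \<forall>\<^sub>F k in sequentially. \<forall>S.
       approximation_set (1 - \<epsilon>) (chain_lp N C k) S \<longrightarrow> infinite S \<or> c * 2 ^ k \<le> real (card S)"
      by (intro exI[of _ 1] conjI always_eventually allI impI) simp_all
  qed
qed

end
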